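(* Suppose that $\{\psi_{j,k}\}_{j\in\mathbb{N}_0,\,k\in\Gamma_j^\psi}$ is any orthonormal basis for $U$ and that $\mathcal{P}$ has the representation $$\mathcal{P}=\sum_{j\in\mathbb{N}_0}\sum_{k\in\Gamma_j^\psi}p_{j,k}\,\psi_{j,k}\otimes\psi_{j,k}\in S^\infty(U).$$ Let $r>0$ and define $\mathcal{P}_j:=\sum_{0\le m<j}\sum_{k\in\Gamma_m^\psi}p_{m,k}\,\psi_{m,k}\otimes\psi_{m,k}$. Then $$\|(\mathcal{P}-\mathcal{P}_j)f\|_U\lesssim 2^{-rj}\,|\mathcal{P}f|_{A^{r,2}(U)}$$ whenever $\mathcal{P}f\in A^{r,2}(U)$. Moreover, whenever $s>r$ and $\mathcal{P}\in\mathbb{A}^{s,2}(U)$, $$|\mathcal{P}-\mathcal{P}_j|_{\mathbb{A}^{r,2}(U)}\lesssim 2^{-j(s-r)}\,|\mathcal{P}|_{\mathbb{A}^{s,2}(U)}.$$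
   Context: $U$ is a real separable Hilbert space ($U=L^2_\mu(\Omega)$). The basis is indexed by a resolution level $j\in\mathbb{N}_0$ and, for each level, an index $k$ in a finite set $\Gamma_j^\psi$. $S^\infty(U)$ denotes the compact operators on $U$; $(u\otimes v)f:=u\,(v,f)_U$; the coefficients $p_{j,k}$ are real. For $r>0$, $$A^{r,2}(U):=\Big\{f\in U\;\Big|\;|f|^2_{A^{r,2}(U)}:=\sum_{j\in\mathbb{N}_0}2^{2rj}\sum_{k\in\Gamma_j^\psi}|(f,\psi_{j,k})_U|^2<\infty\Big\},$$ $$\mathbb{A}^{r,2}(U):=\Big\{\mathcal{P}=\sum_{j\in\mathbb{N}_0}\sum_{k\in\Gamma_j^\psi}p_{j,k}\,\psi_{j,k}\otimes\psi_{j,k}\in S^\infty(U)\;\Big|\;|\mathcal{P}|^2_{\mathbb{A}^{r,2}(U)}:=\sum_{j\in\mathbb{N}_0}2^{2jr}\sum_{k\in\Gamma_j^\psi}|p_{j,k}|^2<\infty\Big\}.$$ $a\lesssim b$ means $a\le c\,b$ with a constant $c>0$ independent of $j$ and $f$. *)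

theory Defs
  imports "HOL-Analysis.Analysis"
begin

definition is_orthonormal_basis ::
    "(nat \<Rightarrow> 'k set) \<Rightarrow> (nat \<Rightarrow> 'k \<Rightarrow> 'u::real_inner) \<Rightarrow> bool" where
  "is_orthonormal_basis \<Gamma> \<psi> \<longleftrightarrow>
     (\<forall>j. \<forall>k\<in>\<Gamma> j. norm (\<psi> j k) = 1) \<and>
     (\<forall>i j. \<forall>k\<in>\<Gamma> i. \<forall>l\<in>\<Gamma> j. (i, k) \<noteq> (j, l) \<longrightarrow> \<psi> i k \<bullet> \<psi> j l = 0) \<and>
     closure (span {\<psi> j k | j k. k \<in> \<Gamma> j}) = UNIV"

definition compact_operators :: "('u::real_normed_vector \<Rightarrow>\<^sub>L 'u) set" where
  "compact_operators = {T. compact (closure (blinfun_apply T ` cball 0 1))}"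

lift_definition otimes_op :: "'u::real_inner \<Rightarrow> 'u \<Rightarrow> 'u \<Rightarrow>\<^sub>L 'u"  (infixr \<open>\<otimes>\<^sub>o\<close> 76)
  is "\<lambda>u v f. (v \<bullet> f) *\<^sub>R u"
  by (intro bounded_linear_scaleR_left[THEN bounded_linear_compose] bounded_linear_inner_right)

lemma otimes_op_apply: "(u \<otimes>\<^sub>o v) f = (v \<bullet> f) *\<^sub>R u"
  by transfer simp

definition level_op ::
    "(nat \<Rightarrow> 'k set) \<Rightarrow> (nat \<Rightarrow> 'k \<Rightarrow> 'u::real_inner) \<Rightarrow> (nat \<Rightarrow> 'k \<Rightarrow> real) \<Rightarrow> nat \<Rightarrow> 'u \<Rightarrow>\<^sub>L 'u" where
  "level_op \<Gamma> \<psi> p m = (\<Sum>k\<in>\<Gamma> m. p m k *\<^sub>R (\<psi> m k \<otimes>\<^sub>o \<psi> m k))"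

definition truncated_op ::
    "(nat \<Rightarrow> 'k set) \<Rightarrow> (nat \<Rightarrow> 'k \<Rightarrow> 'u::real_inner) \<Rightarrow> (nat \<Rightarrow> 'k \<Rightarrow> real) \<Rightarrow> nat \<Rightarrow> 'u \<Rightarrow>\<^sub>L 'u" where
  "truncated_op \<Gamma> \<psi> p j = (\<Sum>m<j. level_op \<Gamma> \<psi> p m)"

(* The series converges in operator norm, the norm of the space of compact operators. *)
definition represents ::
    "(nat \<Rightarrow> 'k set) \<Rightarrow> (nat \<Rightarrow> 'k \<Rightarrow> 'u::real_inner) \<Rightarrow> (nat \<Rightarrow> 'k \<Rightarrow> real) \<Rightarrow> ('u \<Rightarrow>\<^sub>L 'u) \<Rightarrow> bool" where
  "represents \<Gamma> \<psi> p T \<longleftrightarrow> T \<in> compact_operators \<and> level_op \<Gamma> \<psi> p sums T"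

lemma represents_coeff:
  fixes \<psi> :: "nat \<Rightarrow> 'k \<Rightarrow> 'a::real_inner"
  assumes rep: "represents \<Gamma> \<psi> p T" and onb: "is_orthonormal_basis \<Gamma> \<psi>"
    and fin: "\<And>j. finite (\<Gamma> j)" and k: "k \<in> \<Gamma> j"
  shows "p j k = T (\<psi> j k) \<bullet> \<psi> j k"
proof -
  define L :: "('a \<Rightarrow>\<^sub>L 'a) \<Rightarrow> real" where "L S = S (\<psi> j k) \<bullet> \<psi> j k" for S
  have "bounded_linear L"
    unfolding L_def
    by (intro bounded_linear_inner_left[THEN bounded_linear_compose] blinfun.bounded_linear_left)
  then have "(\<lambda>m. L (level_op \<Gamma> \<psi> p m)) sums L T"
    using rep by (auto simp: represents_def intro: bounded_linear.sums)
  moreover have "L (level_op \<Gamma> \<psi> p m) = (if m = j then p j k else 0)" for m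
  proof -
    have n1: "\<psi> j k \<bullet> \<psi> j k = 1"
      using onb k by (simp add: is_orthonormal_basis_def norm_eq_1)
    have orth: "\<psi> m l \<bullet> \<psi> j k = (if m = j \<and> l = k then 1 else 0)" if "l \<in> \<Gamma> m" for l
      using onb k that n1 by (auto simp: is_orthonormal_basis_def)
    have "L (level_op \<Gamma> \<psi> p m) = (\<Sum>l\<in>\<Gamma> m. p m l * (\<psi> m l \<bullet> \<psi> j k) * (\<psi> m l \<bullet> \<psi> j k))"
      by (simp add: L_def level_op_def blinfun.sum_left blinfun.scaleR_left otimes_op_apply
          inner_sum_left mult_ac)
    also have "\<dots> = (\<Sum>l\<in>\<Gamma> m. if l = k then (if m = j then p m l else 0) else 0)"
      by (intro sum.cong) (auto simp: orth)
    also have "\<dots> = (if m = j then p j k else 0)"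
      using fin[of m] k by (simp add: sum.delta)
    finally show ?thesis .
  qed
  ultimately have "(\<lambda>m. if m = j then p j k else 0) sums L T"
    by simp
  moreover have "(\<lambda>m. if m = j then p j k else 0) sums p j k"
    using sums_single[of j "\<lambda>_. p j k"] by simp
  ultimately show ?thesis
    by (auto simp: L_def dest: sums_unique2)
qed

(* By represents_coeff, the coefficients of a representable operator are unique on the index set,
   so the choice below is immaterial. *)
definition coeffs ::
    "(nat \<Rightarrow> 'k set) \<Rightarrow> (nat \<Rightarrow> 'k \<Rightarrow> 'u::real_inner) \<Rightarrow> ('u \<Rightarrow>\<^sub>L 'u) \<Rightarrow> nat \<Rightarrow> 'k \<Rightarrow> real" where
  "coeffs \<Gamma> \<psi> T = (SOME p. represents \<Gamma> \<psi> p T)"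

definition A_space ::
    "(nat \<Rightarrow> 'k set) \<Rightarrow> (nat \<Rightarrow> 'k \<Rightarrow> 'u::real_inner) \<Rightarrow> real \<Rightarrow> 'u set" where
  "A_space \<Gamma> \<psi> r =
     {f. summable (\<lambda>j. 2 powr (2 * r * real j) * (\<Sum>k\<in>\<Gamma> j. \<bar>f \<bullet> \<psi> j k\<bar>\<^sup>2))}"

(* Meaningful only on A_space: suminf of a divergent series is unspecified. *)
definition A_norm ::
    "(nat \<Rightarrow> 'k set) \<Rightarrow> (nat \<Rightarrow> 'k \<Rightarrow> 'u::real_inner) \<Rightarrow> real \<Rightarrow> 'u \<Rightarrow> real" where
  "A_norm \<Gamma> \<psi> r f =
     sqrt (\<Sum>j. 2 powr (2 * r * real j) * (\<Sum>k\<in>\<Gamma> j. \<bar>f \<bullet> \<psi> j k\<bar>\<^sup>2))"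

definition op_A_space ::
    "(nat \<Rightarrow> 'k set) \<Rightarrow> (nat \<Rightarrow> 'k \<Rightarrow> 'u::real_inner) \<Rightarrow> real \<Rightarrow> ('u \<Rightarrow>\<^sub>L 'u) set" where
  "op_A_space \<Gamma> \<psi> r =
     {T. \<exists>p. represents \<Gamma> \<psi> p T \<and>
             summable (\<lambda>j. 2 powr (2 * real j * r) * (\<Sum>k\<in>\<Gamma> j. \<bar>p j k\<bar>\<^sup>2))}"

(* Meaningful only on op_A_space. *)
definition op_A_norm ::
    "(nat \<Rightarrow> 'k set) \<Rightarrow> (nat \<Rightarrow> 'k \<Rightarrow> 'u::real_inner) \<Rightarrow> real \<Rightarrow> ('u \<Rightarrow>\<^sub>L 'u) \<Rightarrow> real" where
  "op_A_norm \<Gamma> \<psi> r T =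
     sqrt (\<Sum>j. 2 powr (2 * real j * r) * (\<Sum>k\<in>\<Gamma> j. \<bar>coeffs \<Gamma> \<psi> T j k\<bar>\<^sup>2))"

end

theory Submission
  imports Defs
begin

text \<open>
  The idea is that \<open>P - P\<^sub>j\<close> is again a diagonal operator in the basis \<open>\<psi>\<close>: its coefficients are
  those of \<open>P\<close> with the levels below \<open>j\<close> set to zero (\<open>represents_minus_truncated_op\<close>). So the
  errors in both parts are weighted sums over the levels \<open>m \<ge> j\<close> only, and on these levels
  trading the weight \<open>2 powr (2 * r * m)\<close> for the larger weight \<open>2 powr (2 * s * m)\<close> gains
  at least the factor \<open>2 powr (- 2 * j * (s - r))\<close> (\<open>weighted_tail\<close>). The constant is 1 in both
  parts.

  For the operator seminorms this is the whole argument. The bound for vectors is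
  the same estimate with the weights \<open>1\<close> and \<open>2 powr (2 * r * m)\<close>, because of a Parseval identity for
  the range of a diagonal operator (\<open>represents_parseval\<close>). Vectors in the range of \<open>P\<close> already come
  as a convergent series with pairwise orthogonal terms, so this identity is just
  Pythagoras for the partial sums, followed by passage to the limit.
\<close>

section \<open>Compact operators\<close>

text \<open>In this form the closure properties of the compact operators reduce to those of compact
  sets.\<close>

lemma compact_operators_iff:
  "T \<in> compact_operators \<longleftrightarrow> (\<exists>K. compact K \<and> blinfun_apply T ` cball 0 1 \<subseteq> K)"
proof
  assume "T \<in> compact_operators"
  then show "\<exists>K. compact K \<and> blinfun_apply T ` cball 0 1 \<subseteq> K"
    by (intro exI[of _ "closure (blinfun_apply T ` cball 0 1)"])
      (simp add: compact_operators_def closure_subset)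
next
  assume "\<exists>K. compact K \<and> blinfun_apply T ` cball 0 1 \<subseteq> K"
  then obtain K where K: "compact K" "blinfun_apply T ` cball 0 1 \<subseteq> K"
    by blast
  then have "closure (blinfun_apply T ` cball 0 1) \<subseteq> K"
    by (simp add: closure_minimal compact_imp_closed)
  then have "compact (K \<inter> closure (blinfun_apply T ` cball 0 1))"
    using K(1) by (intro compact_Int_closed) auto
  with \<open>closure _ \<subseteq> K\<close> show "T \<in> compact_operators"
    by (simp add: compact_operators_def Int_absorb1)
qed

lemma compact_operators_otimes_op: "u \<otimes>\<^sub>o v \<in> compact_operators"
proof -
  have "compact ((\<lambda>c. c *\<^sub>R u) ` {- norm v..norm v})"
    by (intro compact_continuous_image continuous_intros) auto
  moreover have "(u \<otimes>\<^sub>o v) f \<in> (\<lambda>c. c *\<^sub>R u) ` {- norm v..norm v}" if "f \<in> cball 0 1" for f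
  proof -
    have "\<bar>v \<bullet> f\<bar> \<le> norm v * norm f"
      by (rule Cauchy_Schwarz_ineq2)
    also have "\<dots> \<le> norm v"
      using that by (simp add: mult_left_le)
    finally show ?thesis
      by (auto simp: otimes_op_apply abs_le_iff)
  qed
  ultimately show ?thesis
    unfolding compact_operators_iff by blast
qed

lemma subspace_compact_operators: "subspace compact_operators"
proof (rule subspaceI)
  show "0 \<in> compact_operators"
    unfolding compact_operators_iff by (intro exI[of _ "{0}"]) auto
next
  fix S T :: "'a \<Rightarrow>\<^sub>L 'a"
  assume "S \<in> compact_operators" "T \<in> compact_operators"
  then obtain K L where KL: "compact K" "blinfun_apply S ` cball 0 1 \<subseteq> K"
      "compact L" "blinfun_apply T ` cball 0 1 \<subseteq> L"
    unfolding compact_operators_iff by blast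
  then have "compact {x + y |x y. x \<in> K \<and> y \<in> L}"
    by (intro compact_sums)
  moreover have "blinfun_apply (S + T) ` cball 0 1 \<subseteq> {x + y |x y. x \<in> K \<and> y \<in> L}"
    using KL by (fastforce simp: blinfun.add_left)
  ultimately show "S + T \<in> compact_operators"
    unfolding compact_operators_iff by blast
next
  fix c :: real and T :: "'a \<Rightarrow>\<^sub>L 'a"
  assume "T \<in> compact_operators"
  then obtain K where K: "compact K" "blinfun_apply T ` cball 0 1 \<subseteq> K"
    unfolding compact_operators_iff by blast
  then have "compact ((\<lambda>x. c *\<^sub>R x) ` K)"
    by (intro compact_scaling)
  moreover have "blinfun_apply (c *\<^sub>R T) ` cball 0 1 \<subseteq> (\<lambda>x. c *\<^sub>R x) ` K"
    using K by (auto simp: blinfun.scaleR_left)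
  ultimately show "c *\<^sub>R T \<in> compact_operators"
    unfolding compact_operators_iff by blast
qed

lemma compact_operators_truncated_op: "truncated_op \<Gamma> \<psi> p j \<in> compact_operators"
  unfolding truncated_op_def level_op_def
  by (intro subspace_sum[OF subspace_compact_operators]
      subspace_scale[OF subspace_compact_operators] compact_operators_otimes_op)

section \<open>Diagonal operators\<close>

lemma represents_minus_truncated_op:
  assumes "represents \<Gamma> \<psi> p P"
  shows "represents \<Gamma> \<psi> (\<lambda>m k. if m < j then 0 else p m k) (P - truncated_op \<Gamma> \<psi> p j)"
proof -
  have "P - truncated_op \<Gamma> \<psi> p j \<in> compact_operators"
    using assms compact_operators_truncated_op
    by (intro subspace_diff[OF subspace_compact_operators]) (auto simp: represents_def)
  moreover have "(\<lambda>m. level_op \<Gamma> \<psi> p m - (if m \<in> {..<j} then level_op \<Gamma> \<psi> p m else 0))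
      sums (P - truncated_op \<Gamma> \<psi> p j)"
    unfolding truncated_op_def using assms
    by (intro sums_diff sums_If_finite_set) (auto simp: represents_def)
  moreover have "level_op \<Gamma> \<psi> (\<lambda>m k. if m < j then 0 else p m k) =
      (\<lambda>m. level_op \<Gamma> \<psi> p m - (if m \<in> {..<j} then level_op \<Gamma> \<psi> p m else 0))"
    by (auto simp: level_op_def)
  ultimately show ?thesis
    by (simp add: represents_def)
qed

lemma coeffs_eq:
  fixes \<psi> :: "nat \<Rightarrow> 'k \<Rightarrow> 'u::real_inner"
  assumes fin: "\<And>j. finite (\<Gamma> j)" and onb: "is_orthonormal_basis \<Gamma> \<psi>"
    and rep: "represents \<Gamma> \<psi> p T" and k: "k \<in> \<Gamma> j"
  shows "coeffs \<Gamma> \<psi> T j k = p j k"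
proof -
  have "represents \<Gamma> \<psi> (coeffs \<Gamma> \<psi> T) T"
    unfolding coeffs_def by (rule someI[of "\<lambda>p. represents \<Gamma> \<psi> p T", OF rep])
  then show ?thesis
    using represents_coeff[OF _ onb fin k] rep by metis
qed

lemma op_A_norm_eq:
  fixes \<psi> :: "nat \<Rightarrow> 'k \<Rightarrow> 'u::real_inner"
  assumes "\<And>j. finite (\<Gamma> j)" "is_orthonormal_basis \<Gamma> \<psi>" "represents \<Gamma> \<psi> p T"
  shows "op_A_norm \<Gamma> \<psi> r T =
    sqrt (\<Sum>j. 2 powr (2 * real j * r) * (\<Sum>k\<in>\<Gamma> j. \<bar>p j k\<bar>\<^sup>2))"
  unfolding op_A_norm_def using coeffs_eq[OF assms] by (simp cong: sum.cong)

lemma op_A_space_iff: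
  fixes \<psi> :: "nat \<Rightarrow> 'k \<Rightarrow> 'u::real_inner"
  assumes "\<And>j. finite (\<Gamma> j)" "is_orthonormal_basis \<Gamma> \<psi>" "represents \<Gamma> \<psi> p T"
  shows "T \<in> op_A_space \<Gamma> \<psi> r \<longleftrightarrow>
    summable (\<lambda>j. 2 powr (2 * real j * r) * (\<Sum>k\<in>\<Gamma> j. \<bar>p j k\<bar>\<^sup>2))"
proof
  assume "T \<in> op_A_space \<Gamma> \<psi> r"
  then obtain q where q: "represents \<Gamma> \<psi> q T"
      "summable (\<lambda>j. 2 powr (2 * real j * r) * (\<Sum>k\<in>\<Gamma> j. \<bar>q j k\<bar>\<^sup>2))"
    unfolding op_A_space_def by blast
  have "p j k = q j k" if "k \<in> \<Gamma> j" for j k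
    using coeffs_eq[OF assms that] coeffs_eq[OF assms(1,2) q(1) that] by simp
  then show "summable (\<lambda>j. 2 powr (2 * real j * r) * (\<Sum>k\<in>\<Gamma> j. \<bar>p j k\<bar>\<^sup>2))"
    using q(2) by (simp cong: sum.cong)
next
  assume "summable (\<lambda>j. 2 powr (2 * real j * r) * (\<Sum>k\<in>\<Gamma> j. \<bar>p j k\<bar>\<^sup>2))"
  then show "T \<in> op_A_space \<Gamma> \<psi> r"
    unfolding op_A_space_def mem_Collect_eq using assms(3) by (intro exI[of _ p] conjI)
qed

lemma level_op_inner_basis:
  fixes \<psi> :: "nat \<Rightarrow> 'k \<Rightarrow> 'u::real_inner"
  assumes fin: "\<And>j. finite (\<Gamma> j)" and onb: "is_orthonormal_basis \<Gamma> \<psi>" and k: "k \<in> \<Gamma> j"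
  shows "level_op \<Gamma> \<psi> p m f \<bullet> \<psi> j k = (if m = j then p j k * (f \<bullet> \<psi> j k) else 0)"
proof -
  have orth: "\<psi> m l \<bullet> \<psi> j k = (if m = j \<and> l = k then 1 else 0)" if "l \<in> \<Gamma> m" for l
    using onb k that by (auto simp: is_orthonormal_basis_def norm_eq_1)
  have "level_op \<Gamma> \<psi> p m f \<bullet> \<psi> j k = (\<Sum>l\<in>\<Gamma> m. p m l * (\<psi> m l \<bullet> f) * (\<psi> m l \<bullet> \<psi> j k))"
    by (simp add: level_op_def blinfun.sum_left blinfun.scaleR_left otimes_op_apply
        inner_sum_left mult_ac)
  also have "\<dots> = (\<Sum>l\<in>\<Gamma> m. if l = k then (if m = j then p m l * (\<psi> m l \<bullet> f) else 0) else 0)"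
    by (intro sum.cong) (auto simp: orth)
  also have "\<dots> = (if m = j then p j k * (f \<bullet> \<psi> j k) else 0)"
    using fin[of m] k by (simp add: sum.delta inner_commute)
  finally show ?thesis .
qed

lemma represents_inner_basis:
  fixes \<psi> :: "nat \<Rightarrow> 'k \<Rightarrow> 'u::real_inner"
  assumes fin: "\<And>j. finite (\<Gamma> j)" and onb: "is_orthonormal_basis \<Gamma> \<psi>"
    and rep: "represents \<Gamma> \<psi> p T" and k: "k \<in> \<Gamma> j"
  shows "T f \<bullet> \<psi> j k = p j k * (f \<bullet> \<psi> j k)"
proof -
  have "(\<lambda>m. level_op \<Gamma> \<psi> p m f \<bullet> \<psi> j k) sums (T f \<bullet> \<psi> j k)"
    using rep unfolding represents_def
    by (intro bounded_linear.sums[OF bounded_linear_inner_left]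
        bounded_linear.sums[OF blinfun.bounded_linear_left]) auto
  moreover have "(\<lambda>m. level_op \<Gamma> \<psi> p m f \<bullet> \<psi> j k) sums (p j k * (f \<bullet> \<psi> j k))"
    unfolding level_op_inner_basis[OF fin onb k]
    using sums_single[of j "\<lambda>_. p j k * (f \<bullet> \<psi> j k)"] by simp
  ultimately show ?thesis
    by (rule sums_unique2)
qed

text \<open>The series defining \<open>T\<close>, applied to \<open>f\<close>, expands \<open>T f\<close> into orthogonal level terms. Taking
  norms commutes with the limit of its partial sums, and Pythagoras applies to each of these.\<close>

lemma represents_parseval:
  fixes \<psi> :: "nat \<Rightarrow> 'k \<Rightarrow> 'u::real_inner"
  assumes fin: "\<And>j. finite (\<Gamma> j)" and onb: "is_orthonormal_basis \<Gamma> \<psi>"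
    and rep: "represents \<Gamma> \<psi> p T"
  shows "(\<lambda>m. \<Sum>k\<in>\<Gamma> m. \<bar>T f \<bullet> \<psi> m k\<bar>\<^sup>2) sums (norm (T f))\<^sup>2"
proof -
  define g where "g m = level_op \<Gamma> \<psi> p m f" for m
  have inner_g: "g m \<bullet> g n = (if m = n then \<Sum>k\<in>\<Gamma> m. \<bar>T f \<bullet> \<psi> m k\<bar>\<^sup>2 else 0)" for m n
  proof -
    have "g n = (\<Sum>k\<in>\<Gamma> n. (p n k * (f \<bullet> \<psi> n k)) *\<^sub>R \<psi> n k)"
      by (simp add: g_def level_op_def blinfun.sum_left blinfun.scaleR_left otimes_op_apply
          inner_commute)
    then have "g m \<bullet> g n = (\<Sum>k\<in>\<Gamma> n. (p n k * (f \<bullet> \<psi> n k)) * (g m \<bullet> \<psi> n k))"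
      by (simp add: inner_sum_right)
    then show ?thesis
      by (auto simp: g_def level_op_inner_basis[OF fin onb] represents_inner_basis[OF fin onb rep]
          power2_eq_square intro!: sum.cong)
  qed
  have "g sums T f"
    using rep unfolding represents_def g_def
    by (intro bounded_linear.sums[OF blinfun.bounded_linear_left]) auto
  then have "(\<lambda>N. (norm (\<Sum>m<N. g m))\<^sup>2) \<longlonglongrightarrow> (norm (T f))\<^sup>2"
    unfolding sums_def by (intro tendsto_intros)
  moreover have "(norm (\<Sum>m<N. g m))\<^sup>2 = (\<Sum>m<N. \<Sum>k\<in>\<Gamma> m. \<bar>T f \<bullet> \<psi> m k\<bar>\<^sup>2)" for N
  proof -
    have "(norm (\<Sum>m<N. g m))\<^sup>2 = (\<Sum>m<N. (norm (g m))\<^sup>2)"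
      by (rule norm_sum_Pythagorean) (auto simp: pairwise_def orthogonal_def inner_g)
    then show ?thesis
      by (simp add: power2_norm_eq_inner inner_g)
  qed
  ultimately show ?thesis
    by (simp add: sums_def)
qed

section \<open>Decay of weighted tails\<close>

text \<open>For \<open>m \<ge> j\<close> the two weights differ by the factor \<open>2 powr (- 2 * m * (s - r))\<close>, which is
  largest at \<open>m = j\<close>. The factor is written as a square because the sums will be squares of
  seminorms.\<close>

lemma weighted_tail:
  fixes a :: "nat \<Rightarrow> real"
  assumes nonneg: "\<And>m. 0 \<le> a m" and "r \<le> s"
    and summ: "summable (\<lambda>m. 2 powr (2 * s * real m) * a m)"
  shows "summable (\<lambda>m. 2 powr (2 * r * real m) * (if m < j then 0 else a m))"
    and "(\<Sum>m. 2 powr (2 * r * real m) * (if m < j then 0 else a m))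
      \<le> (2 powr (- (real j * (s - r))))\<^sup>2 * (\<Sum>m. 2 powr (2 * s * real m) * a m)"
proof -
  define C where "C = (2 powr (- (real j * (s - r))))\<^sup>2"
  have C: "C = 2 powr (- (2 * real j * (s - r)))"
    by (simp add: C_def power2_eq_square mult.assoc flip: powr_add)
  have le: "2 powr (2 * r * real m) * (if m < j then 0 else a m)
      \<le> C * (2 powr (2 * s * real m) * a m)" for m
  proof (cases "m < j")
    case True
    then show ?thesis
      using nonneg by (simp add: C)
  next
    case False
    then have "real j * (s - r) \<le> real m * (s - r)"
      using \<open>r \<le> s\<close> by (intro mult_right_mono) auto
    then have "2 powr (2 * r * real m) \<le> 2 powr (- (2 * real j * (s - r)) + 2 * s * real m)"
      by (intro powr_mono) (auto simp: algebra_simps)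
    also have "\<dots> = C * 2 powr (2 * s * real m)"
      unfolding C by (rule powr_add)
    finally show ?thesis
      using False by (simp add: mult_right_mono[OF _ nonneg] flip: mult.assoc)
  qed
  have summ_C: "summable (\<lambda>m. C * (2 powr (2 * s * real m) * a m))"
    using summ by (rule summable_mult)
  show summ_tail: "summable (\<lambda>m. 2 powr (2 * r * real m) * (if m < j then 0 else a m))"
    using nonneg by (intro summable_comparison_test'[OF summ_C, of 0]) (auto intro: order.trans[OF _ le])
  show "(\<Sum>m. 2 powr (2 * r * real m) * (if m < j then 0 else a m))
      \<le> (2 powr (- (real j * (s - r))))\<^sup>2 * (\<Sum>m. 2 powr (2 * s * real m) * a m)"
    using suminf_le[OF le summ_tail summ_C] suminf_mult[OF summ] by (simp add: C_def)
qed

section \<open>Approximation by truncation\<close>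

text \<open>By \<open>represents_parseval\<close>, the Hilbert norm on the left is the seminorm of order \<open>0\<close>, so this is
  \<open>weighted_tail\<close> between the orders \<open>0\<close> and \<open>r\<close>. The coefficients of \<open>P f\<close> already contain the
  factors \<open>p m k\<close>, so truncating \<open>P\<close> only removes their low levels.\<close>

lemma norm_minus_truncated_op_le:
  fixes \<psi> :: "nat \<Rightarrow> 'k \<Rightarrow> 'u::real_inner"
  assumes fin: "\<And>j. finite (\<Gamma> j)" and onb: "is_orthonormal_basis \<Gamma> \<psi>"
    and rep: "represents \<Gamma> \<psi> p P" and "0 \<le> r" and Pf: "P f \<in> A_space \<Gamma> \<psi> r"
  shows "norm ((P - truncated_op \<Gamma> \<psi> p j) f) \<le> 2 powr (- (r * real j)) * A_norm \<Gamma> \<psi> r (P f)"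
proof -
  define a where "a m = (\<Sum>k\<in>\<Gamma> m. \<bar>P f \<bullet> \<psi> m k\<bar>\<^sup>2)" for m
  note rep' = represents_minus_truncated_op[OF rep, of j]
  have "(\<Sum>k\<in>\<Gamma> m. \<bar>(P - truncated_op \<Gamma> \<psi> p j) f \<bullet> \<psi> m k\<bar>\<^sup>2) = (if m < j then 0 else a m)" for m
    by (simp add: a_def represents_inner_basis[OF fin onb rep'] represents_inner_basis[OF fin onb rep])
  then have "(norm ((P - truncated_op \<Gamma> \<psi> p j) f))\<^sup>2 = (\<Sum>m. if m < j then 0 else a m)"
    using represents_parseval[OF fin onb rep', of f] by (simp add: sums_iff)
  also have "\<dots> \<le> (2 powr (- (real j * r)))\<^sup>2 * (\<Sum>m. 2 powr (2 * r * real m) * a m)"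
    using weighted_tail(2)[of a 0 r j] Pf \<open>0 \<le> r\<close>
    by (simp add: a_def A_space_def sum_nonneg)
  finally show ?thesis
    using real_le_rsqrt
    by (fastforce simp: a_def A_norm_def real_sqrt_mult mult.commute)
qed

lemma op_A_norm_minus_truncated_op_le:
  fixes \<psi> :: "nat \<Rightarrow> 'k \<Rightarrow> 'u::real_inner"
  assumes fin: "\<And>j. finite (\<Gamma> j)" and onb: "is_orthonormal_basis \<Gamma> \<psi>"
    and rep: "represents \<Gamma> \<psi> p P" and "r \<le> s" and P: "P \<in> op_A_space \<Gamma> \<psi> s"
  shows "P - truncated_op \<Gamma> \<psi> p j \<in> op_A_space \<Gamma> \<psi> r"
    and "op_A_norm \<Gamma> \<psi> r (P - truncated_op \<Gamma> \<psi> p j)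
      \<le> 2 powr (- (real j * (s - r))) * op_A_norm \<Gamma> \<psi> s P"
proof -
  define a where "a m = (\<Sum>k\<in>\<Gamma> m. \<bar>p m k\<bar>\<^sup>2)" for m
  have a_nonneg: "0 \<le> a m" for m
    by (simp add: a_def sum_nonneg)
  note rep' = represents_minus_truncated_op[OF rep, of j]
  have tail: "(\<Sum>k\<in>\<Gamma> m. \<bar>if m < j then 0 else p m k\<bar>\<^sup>2) = (if m < j then 0 else a m)" for m
    by (simp add: a_def)
  have comm: "2 * real m * t = 2 * t * real m" for m and t :: real
    by simp
  have summ: "summable (\<lambda>m. 2 powr (2 * s * real m) * a m)"
    using P unfolding op_A_space_iff[OF fin onb rep] a_def comm .
  show "P - truncated_op \<Gamma> \<psi> p j \<in> op_A_space \<Gamma> \<psi> r"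
    unfolding op_A_space_iff[OF fin onb rep'] tail comm
    by (rule weighted_tail(1)[OF a_nonneg \<open>r \<le> s\<close> summ])
  have "op_A_norm \<Gamma> \<psi> r (P - truncated_op \<Gamma> \<psi> p j) =
      sqrt (\<Sum>m. 2 powr (2 * r * real m) * (if m < j then 0 else a m))"
    unfolding op_A_norm_eq[OF fin onb rep'] tail comm ..
  also have "\<dots> \<le> sqrt ((2 powr (- (real j * (s - r))))\<^sup>2 * (\<Sum>m. 2 powr (2 * s * real m) * a m))"
    using weighted_tail(2)[OF a_nonneg \<open>r \<le> s\<close> summ] by simp
  also have "\<dots> = 2 powr (- (real j * (s - r))) * op_A_norm \<Gamma> \<psi> s P"
    unfolding op_A_norm_eq[OF fin onb rep] comm a_def by (simp add: real_sqrt_mult)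
  finally show "op_A_norm \<Gamma> \<psi> r (P - truncated_op \<Gamma> \<psi> p j)
      \<le> 2 powr (- (real j * (s - r))) * op_A_norm \<Gamma> \<psi> s P" .
qed

theorem theorem6p2:
  fixes \<Gamma> :: "nat \<Rightarrow> 'k set"
    and \<psi> :: "nat \<Rightarrow> 'k \<Rightarrow> 'u::{real_inner, polish_space}"
    and p :: "nat \<Rightarrow> 'k \<Rightarrow> real"
    and P :: "'u \<Rightarrow>\<^sub>L 'u"
    and r :: real
  assumes "\<And>j. finite (\<Gamma> j)"
    and "is_orthonormal_basis \<Gamma> \<psi>"
    and "represents \<Gamma> \<psi> p P"
    and "r > 0"
  shows "(\<exists>c>0. \<forall>j f. P f \<in> A_space \<Gamma> \<psi> r \<longrightarrow>
            norm ((P - truncated_op \<Gamma> \<psi> p j) f) \<le> c * 2 powr (- (r * real j)) * A_norm \<Gamma> \<psi> r (P f)) \<and>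
         (\<forall>s>r. P \<in> op_A_space \<Gamma> \<psi> s \<longrightarrow>
            (\<exists>c>0. \<forall>j. P - truncated_op \<Gamma> \<psi> p j \<in> op_A_space \<Gamma> \<psi> r \<and>
               op_A_norm \<Gamma> \<psi> r (P - truncated_op \<Gamma> \<psi> p j)
                 \<le> c * 2 powr (- (real j * (s - r))) * op_A_norm \<Gamma> \<psi> s P))"
proof (intro conjI allI impI)
  show "\<exists>c>0. \<forall>j f. P f \<in> A_space \<Gamma> \<psi> r \<longrightarrow>
      norm ((P - truncated_op \<Gamma> \<psi> p j) f) \<le> c * 2 powr (- (r * real j)) * A_norm \<Gamma> \<psi> r (P f)"
    using norm_minus_truncated_op_le[OF assms(1-3)] \<open>r > 0\<close> by (intro exI[of _ 1]) simp
next
  fix s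
  assume "s > r" and P: "P \<in> op_A_space \<Gamma> \<psi> s"
  then show "\<exists>c>0. \<forall>j. P - truncated_op \<Gamma> \<psi> p j \<in> op_A_space \<Gamma> \<psi> r \<and>
      op_A_norm \<Gamma> \<psi> r (P - truncated_op \<Gamma> \<psi> p j)
        \<le> c * 2 powr (- (real j * (s - r))) * op_A_norm \<Gamma> \<psi> s P"
    using op_A_norm_minus_truncated_op_le[OF assms(1-3) _ P, of r] by (intro exI[of _ 1]) simp
qed

end
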